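(* Let $G\in\pi_n(\gamma_1,\gamma_2)$. Then there exists a unique function $g\big((u_1,v_1),\ldots,(u_n,v_n);h\big)$, $g(\cdot\,;h):(\mathbb R^2)^n\to\mathbb R$, that is symmetric in its $n$ arguments $(u_i,v_i)\in\mathbb R^2$, multilinear (linear in each argument $(u_i,v_i)\in\mathbb R^2$ separately), and reduces to $G$ along the $h$--$\gamma$ diagonal, i.e. for all $t\in\mathbb R$ $$g\big(\Gamma(t),\Gamma(t-h),\ldots,\Gamma(t-(n-1)h);h\big)=G(t).$$
   Context: Let $n\ge 1$ be an integer and $h\in\mathbb R$ fixed. Let $\gamma_1,\gamma_2:\mathbb R\to\mathbb R$ be continuous, linearly independent functions, and write $\Gamma(t)=(\gamma_1(t),\gamma_2(t))$. They are assumed translation invariant: for every $s\in\mathbb R$ there is an invertible $2\times2$ matrix $C(s)$ with $\begin{pmatrix}\gamma_1(x-s)\\ \gamma_2(x-s)\end{pmatrix}=C(s)\begin{pmatrix}\gamma_1(x)\\ \gamma_2(x)\end{pmatrix}$ for all $x$. Put $\pi_n(\gamma_1,\gamma_2)=\mathrm{span}\{\gamma_1^{n-k}\gamma_2^{k}\}_{k=0}^n$. For $0\le k\le n$ put $G_{n,k}(t;h)=\sum_{I\subseteq\{1,\ldots,n\},\,|I|=k}\ \prod_{i\in I}\gamma_1(t-(i-1)h)\prod_{i\in\{1,\ldots,n\}\setminus I}\gamma_2(t-(i-1)h)$. Standing assumption: $h$ is such that the functions $t\mapsto G_{n,k}(t;h)$, $k=0,\ldots,n$, are linearly independent. *)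

theory Defs
  imports "HOL-Analysis.Analysis" "HOL-Library.Function_Algebras"
    "HOL-Combinatorics.Permutations"
begin

text \<open>The real vector space of all functions \<open>real \<Rightarrow> real\<close>; its notions are used below as
  \<open>fun_space.span\<close> and \<open>fun_space.independent\<close>.\<close>

interpretation fun_space: vector_space "\<lambda>(c::real) (f::real \<Rightarrow> real) x. c * f x"
  by unfold_locales (auto simp: fun_eq_iff algebra_simps)

text \<open>The library notion of independence concerns sets; for an indexed family,
  injectivity has to be required as well.\<close>

definition independent_family :: "('i \<Rightarrow> real \<Rightarrow> real) \<Rightarrow> 'i set \<Rightarrow> bool" where
  "independent_family f I \<longleftrightarrow> inj_on f I \<and> fun_space.independent (f ` I)"

definition curve :: "(real \<Rightarrow> real) \<Rightarrow> (real \<Rightarrow> real) \<Rightarrow> real \<Rightarrow> real^2" where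
  "curve \<gamma>\<^sub>1 \<gamma>\<^sub>2 t = vector [\<gamma>\<^sub>1 t, \<gamma>\<^sub>2 t]"

definition translation_invariant :: "(real \<Rightarrow> real) \<Rightarrow> (real \<Rightarrow> real) \<Rightarrow> bool" where
  "translation_invariant \<gamma>\<^sub>1 \<gamma>\<^sub>2 \<longleftrightarrow>
     (\<forall>s. \<exists>C :: real^2^2. invertible C \<and>
        (\<forall>x. curve \<gamma>\<^sub>1 \<gamma>\<^sub>2 (x - s) = C *v curve \<gamma>\<^sub>1 \<gamma>\<^sub>2 x))"

definition pi_space :: "nat \<Rightarrow> (real \<Rightarrow> real) \<Rightarrow> (real \<Rightarrow> real) \<Rightarrow> (real \<Rightarrow> real) set" where
  "pi_space n \<gamma>\<^sub>1 \<gamma>\<^sub>2 = fun_space.span ((\<lambda>k x. \<gamma>\<^sub>1 x ^ (n - k) * \<gamma>\<^sub>2 x ^ k) ` {0..n})"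

definition G_fun ::
  "nat \<Rightarrow> (real \<Rightarrow> real) \<Rightarrow> (real \<Rightarrow> real) \<Rightarrow> real \<Rightarrow> nat \<Rightarrow> real \<Rightarrow> real" where
  "G_fun n \<gamma>\<^sub>1 \<gamma>\<^sub>2 h k t =
     (\<Sum>I | I \<subseteq> {1..n} \<and> card I = k.
        (\<Prod>i\<in>I. \<gamma>\<^sub>1 (t - (real i - 1) * h)) *
        (\<Prod>i\<in>{1..n} - I. \<gamma>\<^sub>2 (t - (real i - 1) * h)))"

text \<open>\<open>args n\<close> is the \<open>n\<close>-fold cartesian power of \<open>real^2\<close>, with tuples indexed by \<open>{1..n}\<close>
  and \<open>undefined\<close> elsewhere. Functions on it are likewise taken in
  \<open>args n \<rightarrow>\<^sub>E UNIV\<close>, so that equality in HOL is equality on \<open>args n\<close>.\<close>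

definition args :: "nat \<Rightarrow> (nat \<Rightarrow> real^2) set" where
  "args n = {1..n} \<rightarrow>\<^sub>E UNIV"

definition symmetric_args :: "nat \<Rightarrow> ((nat \<Rightarrow> real^2) \<Rightarrow> real) \<Rightarrow> bool" where
  "symmetric_args n g \<longleftrightarrow> (\<forall>p w. p permutes {1..n} \<longrightarrow> w \<in> args n \<longrightarrow> g (w \<circ> p) = g w)"

definition multilinear :: "nat \<Rightarrow> ((nat \<Rightarrow> real^2) \<Rightarrow> real) \<Rightarrow> bool" where
  "multilinear n g \<longleftrightarrow> (\<forall>w\<in>args n. \<forall>i\<in>{1..n}. linear (\<lambda>z. g (w(i := z))))"

definition h_diagonal ::
  "nat \<Rightarrow> (real \<Rightarrow> real) \<Rightarrow> (real \<Rightarrow> real) \<Rightarrow> real \<Rightarrow> real \<Rightarrow> nat \<Rightarrow> real^2" where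
  "h_diagonal n \<gamma>\<^sub>1 \<gamma>\<^sub>2 h t = (\<lambda>i\<in>{1..n}. curve \<gamma>\<^sub>1 \<gamma>\<^sub>2 (t - (real i - 1) * h))"

end

(* A symmetric multilinear form is a linear combination of the elementary forms sym_form n k,
   which restrict to the G_{n,k} along the diagonal; independence of the G_{n,k} gives uniqueness.
   By translation invariance the G_{n,k} lie in pi_n, which is spanned by n+1 functions, so
   by the exchange lemma these n+1 independent functions span pi_n, which gives existence. *)
theory Submission
  imports Defs
begin

section \<open>Independent families and spans of real functions\<close>

lemma sum_fun_apply: "(\<Sum>a\<in>A. f a) x = (\<Sum>a\<in>A. f a x :: 'b::comm_monoid_add)"
  by (induction A rule: infinite_finite_induct) auto

lemma independent_familyD:
  assumes "independent_family f I" "finite I" "\<And>x. (\<Sum>i\<in>I. c i * f i x) = 0" "i \<in> I"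
  shows "c i = 0"
proof -
  have inj: "inj_on f I" and ind: "fun_space.independent (f ` I)"
    using assms(1) by (auto simp: independent_family_def)
  \<comment> \<open>Library independence needs coefficients indexed by vectors; injectivity of
    \<open>f\<close> lets \<open>the_inv_into\<close> carry \<open>c\<close> over to the image
    set.\<close>
  have "(\<Sum>v\<in>f ` I. (\<lambda>x. c (the_inv_into I f v) * v x)) = 0"
    using assms(3) by (simp add: fun_eq_iff sum_fun_apply sum.reindex[OF inj] the_inv_into_f_f[OF inj])
  from fun_space.independentD[OF ind _ subset_refl this, of "f i"]
  show ?thesis using assms by (simp add: the_inv_into_f_f[OF inj])
qed

lemma span_independent_family:
  assumes "independent_family f I" "finite I" "v \<in> fun_space.span (f ` I)"
  shows "\<exists>c. \<forall>x. v x = (\<Sum>i\<in>I. c i * f i x)"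
proof -
  have inj: "inj_on f I"
    using assms(1) by (auto simp: independent_family_def)
  obtain u where "v = (\<Sum>w\<in>f ` I. (\<lambda>x. u w * w x))"
    using assms by (auto simp: fun_space.span_finite)
  then have "\<forall>x. v x = (\<Sum>i\<in>I. u (f i) * f i x)"
    by (simp add: sum_fun_apply sum.reindex[OF inj])
  then show ?thesis by (rule exI[of _ "\<lambda>i. u (f i)"])
qed

text \<open>A vector of the span of \<open>T\<close> outside the span of the family would extend it
  to \<open>card I + 1\<close> independent vectors inside the span of \<open>T\<close>, more than
  the exchange bound \<open>card T\<close> allows.\<close>

lemma independent_family_spans:
  assumes ind: "independent_family f I" and fin: "finite I" "finite T"
    and sub: "f ` I \<subseteq> fun_space.span T" and card: "card T \<le> card I"
  shows "fun_space.span T \<subseteq> fun_space.span (f ` I)"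
proof -
  have inj: "inj_on f I" and indep: "fun_space.independent (f ` I)"
    using ind by (auto simp: independent_family_def)
  show ?thesis
  proof (rule ccontr)
    assume "\<not> ?thesis"
    then obtain v where v: "v \<in> fun_space.span T" "v \<notin> fun_space.span (f ` I)" by blast
    then have "fun_space.independent (insert v (f ` I))"
      using fun_space.independent_insertI[OF _ indep] by blast
    then have "card (insert v (f ` I)) \<le> card T"
      using fun_space.independent_span_bound[OF fin(2)] sub v(1) by blast
    moreover have "v \<notin> f ` I" using v(2) fun_space.span_base by blast
    ultimately show False using card fin(1) by (simp add: card_image[OF inj])
  qed
qed

section \<open>Membership of the \<open>G_fun\<close> functions in \<open>pi_space\<close>\<close>

lemma translation_invariant_shift:
  assumes "translation_invariant \<gamma>\<^sub>1 \<gamma>\<^sub>2"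
  obtains a b c d where
    "\<And>x. \<gamma>\<^sub>1 (x - s) = a * \<gamma>\<^sub>1 x + b * \<gamma>\<^sub>2 x" "\<And>x. \<gamma>\<^sub>2 (x - s) = c * \<gamma>\<^sub>1 x + d * \<gamma>\<^sub>2 x"
proof -
  obtain C :: "real^2^2" where C: "curve \<gamma>\<^sub>1 \<gamma>\<^sub>2 (x - s) = C *v curve \<gamma>\<^sub>1 \<gamma>\<^sub>2 x" for x
    using assms unfolding translation_invariant_def by blast
  have "\<gamma>\<^sub>1 (x - s) = C$1$1 * \<gamma>\<^sub>1 x + C$1$2 * \<gamma>\<^sub>2 x"
    "\<gamma>\<^sub>2 (x - s) = C$2$1 * \<gamma>\<^sub>1 x + C$2$2 * \<gamma>\<^sub>2 x" for x
    using arg_cong[OF C[of x], of "\<lambda>v. v $ 1"] arg_cong[OF C[of x], of "\<lambda>v. v $ 2"]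
    by (simp_all add: curve_def matrix_vector_mult_def sum_2)
  then show ?thesis using that by blast
qed

lemma sum_mem_span:
  assumes "\<And>a. a \<in> A \<Longrightarrow> f a \<in> fun_space.span S"
  shows "(\<lambda>x. \<Sum>a\<in>A. f a x) \<in> fun_space.span S"
  using fun_space.span_sum[of A f S] assms by (simp add: sum_fun_apply[abs_def])

text \<open>Expanding the product means choosing one term from each factor; every choice yields a
  monomial of total degree \<open>card A\<close> in the two functions.\<close>

lemma prod_linear_combinations_in_pi_space:
  assumes "finite A"
  shows "(\<lambda>x. \<Prod>i\<in>A. a i * \<gamma>\<^sub>1 x + b i * \<gamma>\<^sub>2 x) \<in> pi_space (card A) \<gamma>\<^sub>1 \<gamma>\<^sub>2"
proof -
  let ?e = "\<lambda>k x. \<gamma>\<^sub>1 x ^ (card A - k) * \<gamma>\<^sub>2 x ^ k"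
  \<comment> \<open>\<open>X\<close> collects the factors that contribute their
    \<open>\<gamma>\<^sub>1\<close> term. The index of \<open>?e\<close> counts powers of
    \<open>\<gamma>\<^sub>2\<close>, hence \<open>card A - card X\<close>.\<close>
  have "(\<lambda>x. \<Prod>i\<in>A. a i * \<gamma>\<^sub>1 x + b i * \<gamma>\<^sub>2 x) =
    (\<lambda>x. \<Sum>X\<in>Pow A. (prod a X * prod b (A - X)) * ?e (card A - card X) x)"
    using assms by (auto simp: prod_add prod.distrib card_Diff_subset finite_subset card_mono
        intro!: sum.cong)
  also have "\<dots> \<in> fun_space.span (?e ` {0..card A})"
    by (intro sum_mem_span fun_space.span_scale fun_space.span_base) auto
  finally show ?thesis by (simp add: pi_space_def)
qed

text \<open>Each shifted factor is a combination of the unshifted functions with coefficients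
  independent of \<open>t\<close>, so every summand is a product of \<open>n\<close> such
  combinations.\<close>

lemma G_fun_in_pi_space:
  assumes "translation_invariant \<gamma>\<^sub>1 \<gamma>\<^sub>2"
  shows "G_fun n \<gamma>\<^sub>1 \<gamma>\<^sub>2 h k \<in> pi_space n \<gamma>\<^sub>1 \<gamma>\<^sub>2"
proof -
  have "\<forall>s. \<exists>a b c d. \<forall>x. \<gamma>\<^sub>1 (x - s) = a * \<gamma>\<^sub>1 x + b * \<gamma>\<^sub>2 x \<and> \<gamma>\<^sub>2 (x - s) = c * \<gamma>\<^sub>1 x + d * \<gamma>\<^sub>2 x"
    using translation_invariant_shift[OF assms] by metis
  then obtain a b c d where shift:
    "\<And>s x. \<gamma>\<^sub>1 (x - s) = a s * \<gamma>\<^sub>1 x + b s * \<gamma>\<^sub>2 x"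
    "\<And>s x. \<gamma>\<^sub>2 (x - s) = c s * \<gamma>\<^sub>1 x + d s * \<gamma>\<^sub>2 x"
    by metis
  let ?s = "\<lambda>i. (real i - 1) * h"
  have "(\<lambda>t. (\<Prod>i\<in>I. \<gamma>\<^sub>1 (t - ?s i)) * (\<Prod>i\<in>{1..n} - I. \<gamma>\<^sub>2 (t - ?s i))) \<in> pi_space n \<gamma>\<^sub>1 \<gamma>\<^sub>2"
    if I: "I \<subseteq> {1..n}" for I
  proof -
    have "(\<Prod>i\<in>I. \<gamma>\<^sub>1 (t - ?s i)) * (\<Prod>i\<in>{1..n} - I. \<gamma>\<^sub>2 (t - ?s i)) =
        (\<Prod>i\<in>{1..n}. (if i \<in> I then a (?s i) else c (?s i)) * \<gamma>\<^sub>1 t +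
          (if i \<in> I then b (?s i) else d (?s i)) * \<gamma>\<^sub>2 t)" for t
      \<comment> \<open>Splitting the single product at \<open>I\<close> recovers the two products,
        as the conditionals are constant on each piece.\<close>
      unfolding prod.subset_diff[OF I finite_atLeastAtMost]
      by (simp add: shift mult.commute)
    then show ?thesis
      using prod_linear_combinations_in_pi_space[of "{1..n}"
          "\<lambda>i. if i \<in> I then a (?s i) else c (?s i)" \<gamma>\<^sub>1 "\<lambda>i. if i \<in> I then b (?s i) else d (?s i)" \<gamma>\<^sub>2]
      by simp
  qed
  then show ?thesis
    unfolding pi_space_def G_fun_def[abs_def] by (intro sum_mem_span) auto
qed

section \<open>Elementary symmetric multilinear forms\<close>

text \<open>This is the coefficient of \<open>x ^ k\<close> in the product of the linear polynomials
  \<open>w i $ 1 * x + w i $ 2\<close> over \<open>i\<close> in \<open>{1..n}\<close>.\<close>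

definition sym_form :: "nat \<Rightarrow> nat \<Rightarrow> (nat \<Rightarrow> real^2) \<Rightarrow> real" where
  "sym_form n k w = (\<Sum>I | I \<subseteq> {1..n} \<and> card I = k.
     (\<Prod>i\<in>I. w i $ 1) * (\<Prod>i\<in>{1..n} - I. w i $ 2))"

lemma sym_form_h_diagonal: "sym_form n k (h_diagonal n \<gamma>\<^sub>1 \<gamma>\<^sub>2 h t) = G_fun n \<gamma>\<^sub>1 \<gamma>\<^sub>2 h k t"
  unfolding sym_form_def G_fun_def
  by (intro sum.cong refl arg_cong2[of _ _ _ _ "(*)"] prod.cong)
    (auto simp: h_diagonal_def curve_def subset_iff)

text \<open>A permutation maps \<open>k\<close>-subsets bijectively to \<open>k\<close>-subsets and
  complements to complements, so it merely reorders the summands.\<close>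

lemma sym_form_permutes:
  assumes p: "p permutes {1..n}"
  shows "sym_form n k (w \<circ> p) = sym_form n k w"
proof -
  have inj: "inj_on p I" for I
    using permutes_inj[OF p] by (rule inj_on_subset) simp
  have im: "p ` ({1..n} - I) = {1..n} - p ` I" for I
    using image_set_diff[OF permutes_inj[OF p]] permutes_image[OF p] by simp
  let ?S = "{I. I \<subseteq> {1..n} \<and> card I = k}"
  have bij: "bij_betw ((`) p) ?S ?S"
    unfolding bij_betw_def
  proof
    show inj_image: "inj_on ((`) p) ?S"
      using inj_image_eq_iff[OF permutes_inj[OF p]] by (auto simp: inj_on_def)
    have "p ` I \<in> ?S" if "I \<in> ?S" for I
      using that image_mono[of I "{1..n}" p] permutes_image[OF p] by (simp add: card_image[OF inj])
    \<comment> \<open>An injective self-map of a finite set is onto.\<close>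
    then show "(`) p ` ?S = ?S"
      by (intro endo_inj_surj inj_image image_subsetI) auto
  qed
  show ?thesis
    unfolding sym_form_def
    by (subst (2) sum.reindex_bij_betw[OF bij, symmetric])
      (simp only: im[symmetric] prod.reindex[OF inj] o_def)
qed

text \<open>The index \<open>i\<close> lies in exactly one of \<open>I\<close> and its complement,
  so each summand has exactly one coordinate of the argument \<open>z\<close> as a factor.\<close>

lemma sym_form_linear:
  assumes "i \<in> {1..n}"
  shows "linear (\<lambda>z. sym_form n k (w(i := z)))"
proof -
  have "linear (\<lambda>z. (\<Prod>j\<in>I. (w(i := z)) j $ 1) * (\<Prod>j\<in>{1..n} - I. (w(i := z)) j $ 2))"
    if I: "I \<subseteq> {1..n}" for I
  proof (cases "i \<in> I")
    case True
    have "(\<Prod>j\<in>I. (w(i := z)) j $ 1) = z $ 1 * (\<Prod>j\<in>I - {i}. w j $ 1)" for z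
      using finite_subset[OF I] True by (auto simp: prod.remove[of I i] intro!: prod.cong)
    moreover have "(\<Prod>j\<in>{1..n} - I. (w(i := z)) j $ 2) = (\<Prod>j\<in>{1..n} - I. w j $ 2)" for z
      using True by (intro prod.cong) auto
    ultimately show ?thesis
      unfolding linear_iff by (simp only:) (simp add: algebra_simps)
  next
    case False
    have "(\<Prod>j\<in>{1..n} - I. (w(i := z)) j $ 2) = z $ 2 * (\<Prod>j\<in>{1..n} - I - {i}. w j $ 2)" for z
      using assms False
      by (subst prod.remove[of "{1..n} - I" i]) (auto intro!: arg_cong2[of _ _ _ _ "(*)"] prod.cong)
    moreover have "(\<Prod>j\<in>I. (w(i := z)) j $ 1) = (\<Prod>j\<in>I. w j $ 1)" for z
      using False by (intro prod.cong) auto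
    ultimately show ?thesis
      unfolding linear_iff by (simp only:) (simp add: algebra_simps)
  qed
  then show ?thesis
    unfolding sym_form_def by (intro linear_compose_sum) auto
qed

section \<open>Expansion of symmetric multilinear forms in the standard basis\<close>

lemma sum_Pow_insert:
  assumes "finite A" "a \<notin> A"
  shows "(\<Sum>I\<in>Pow (insert a A). f I) = (\<Sum>I\<in>Pow A. f (insert a I) + f I)"
proof -
  have "inj_on (insert a) (Pow A)"
    using assms(2) by (intro inj_onI) (metis PowD insert_ident subsetD)
  then show ?thesis
    unfolding Pow_insert using assms
    by (subst sum.union_disjoint) (auto simp: sum.reindex sum.distrib add.commute)
qed

text \<open>Only the arguments indexed by \<open>J\<close> are expanded in the basis
  \<open>axis 1 1\<close>, \<open>axis 2 1\<close>, which permits induction on \<open>J\<close>; the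
  full expansion is the case \<open>J = {1..n}\<close>.\<close>

lemma multilinear_expansion:
  assumes g: "multilinear n g" and w: "w \<in> args n" and J: "J \<subseteq> {1..n}"
  shows "g w = (\<Sum>I\<in>Pow J. (\<Prod>i\<in>I. w i $ 1) * (\<Prod>i\<in>J - I. w i $ 2) *
    g (\<lambda>i. if i \<in> I then axis 1 1 else if i \<in> J then axis 2 1 else w i))"
  using finite_subset[OF J finite_atLeastAtMost] J
proof (induction J rule: finite_induct)
  case empty
  then show ?case by simp
next
  case (insert j J)
  define v where "v J I = (\<lambda>i. if i \<in> I then axis 1 1 else if i \<in> J then axis 2 1 else w i)" for J I
  have step: "g (v J I) = w j $ 1 * g (v (insert j J) (insert j I)) + w j $ 2 * g (v (insert j J) I)"
    if I: "I \<subseteq> J" for I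
  proof -
    have "v J I \<in> args n"
      using w insert.prems I by (auto simp: args_def v_def PiE_iff extensional_def)
    then have lin: "linear (\<lambda>z. g ((v J I)(j := z)))"
      using g insert.prems by (auto simp: multilinear_def)
    \<comment> \<open>Since \<open>j\<close> is not in \<open>J\<close>, slot \<open>j\<close> still
      holds \<open>w j\<close>, which is now written in the basis.\<close>
    have "v J I = (v J I)(j := w j $ 1 *\<^sub>R axis 1 1 + w j $ 2 *\<^sub>R axis 2 1)"
      using insert.hyps I by (auto simp: fun_eq_iff v_def vec_eq_iff forall_2 axis_def)
    then have "g (v J I) = g ((v J I)(j := w j $ 1 *\<^sub>R axis 1 1 + w j $ 2 *\<^sub>R axis 2 1))"
      by metis
    also have "\<dots> = w j $ 1 * g ((v J I)(j := axis 1 1)) + w j $ 2 * g ((v J I)(j := axis 2 1))"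
      using linear_add[OF lin] linear_scale[OF lin] by simp
    also have "(v J I)(j := axis 1 1) = v (insert j J) (insert j I)"
      by (auto simp: v_def fun_eq_iff)
    also have "(v J I)(j := axis 2 1) = v (insert j J) I"
      using I insert.hyps by (auto simp: v_def fun_eq_iff)
    finally show ?thesis .
  qed
  have "g w = (\<Sum>I\<in>Pow J. (\<Prod>i\<in>I. w i $ 1) * (\<Prod>i\<in>J - I. w i $ 2) * g (v J I))"
    using insert by (simp add: v_def)
  also have "\<dots> = (\<Sum>I\<in>Pow J.
      (\<Prod>i\<in>insert j I. w i $ 1) * (\<Prod>i\<in>insert j J - insert j I. w i $ 2) *
        g (v (insert j J) (insert j I)) +
      (\<Prod>i\<in>I. w i $ 1) * (\<Prod>i\<in>insert j J - I. w i $ 2) * g (v (insert j J) I))"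
  proof (rule sum.cong[OF refl])
    fix I assume "I \<in> Pow J"
    then have I: "I \<subseteq> J" "finite I" "j \<notin> I" "insert j J - insert j I = J - I"
      "insert j J - I = insert j (J - I)"
      using insert.hyps finite_subset by auto
    show "(\<Prod>i\<in>I. w i $ 1) * (\<Prod>i\<in>J - I. w i $ 2) * g (v J I) =
      (\<Prod>i\<in>insert j I. w i $ 1) * (\<Prod>i\<in>insert j J - insert j I. w i $ 2) *
        g (v (insert j J) (insert j I)) +
      (\<Prod>i\<in>I. w i $ 1) * (\<Prod>i\<in>insert j J - I. w i $ 2) * g (v (insert j J) I)"
      unfolding I(4,5) step[OF I(1)] using I(2,3) insert.hyps by (simp add: algebra_simps)
  qed
  also have "\<dots> = (\<Sum>I\<in>Pow (insert j J). (\<Prod>i\<in>I. w i $ 1) * (\<Prod>i\<in>insert j J - I. w i $ 2) *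
      g (v (insert j J) I))"
    by (rule sum_Pow_insert[symmetric]) (use insert.hyps in auto)
  finally show ?case by (simp add: v_def)
qed

text \<open>A bijection from \<open>A\<close> to \<open>B\<close> is glued to one between the
  complements, which also have equal size, and to the identity outside \<open>S\<close>.\<close>

lemma permutation_mapping_subset:
  assumes "finite S" "A \<subseteq> S" "B \<subseteq> S" "card A = card B"
  obtains p where "p permutes S" "\<And>x. x \<in> S \<Longrightarrow> p x \<in> B \<longleftrightarrow> x \<in> A"
proof -
  obtain f where f: "bij_betw f A B"
    using assms finite_same_card_bij finite_subset by metis
  obtain f' where f': "bij_betw f' (S - A) (S - B)"
    using assms finite_same_card_bij[of "S - A" "S - B"] by (auto simp: card_Diff_subset finite_subset)
  define p where "p = (\<lambda>x. if x \<in> A then f x else if x \<in> S then f' x else x)"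
  have "bij_betw p (A \<union> (S - A)) (B \<union> (S - B))"
  proof (rule bij_betw_combine)
    show "bij_betw p A B" using f by (subst bij_betw_cong[of _ p f]) (auto simp: p_def)
    show "bij_betw p (S - A) (S - B)" using f' by (subst bij_betw_cong[of _ p f']) (auto simp: p_def)
  qed auto
  moreover have "A \<union> (S - A) = S" "B \<union> (S - B) = S" using assms by auto
  ultimately have "p permutes S"
    using assms(2) by (intro bij_imp_permutes) (auto simp: p_def)
  moreover have "p x \<in> B \<longleftrightarrow> x \<in> A" if "x \<in> S" for x
    using that bij_betwE[OF f] bij_betwE[OF f'] by (auto simp: p_def)
  ultimately show ?thesis using that by blast
qed

text \<open>By symmetry, the value of \<open>g\<close> on a tuple of basis vectors depends only on
  how many are \<open>axis 1 1\<close>; grouping the expansion by this number produces the forms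
  \<open>sym_form n k\<close>.\<close>

lemma symmetric_multilinear_eq_sum_sym_form:
  assumes sym: "symmetric_args n g" and g: "multilinear n g"
  shows "\<exists>c. \<forall>w\<in>args n. g w = (\<Sum>k\<in>{0..n}. c k * sym_form n k w)"
proof -
  define v :: "nat set \<Rightarrow> nat \<Rightarrow> real^2" where
    "v I = (\<lambda>i\<in>{1..n}. if i \<in> I then axis 1 1 else axis 2 1)" for I
  \<comment> \<open>The initial segment \<open>{1..card I}\<close> represents all subsets of the
    same size; its value under \<open>g\<close> becomes the coefficient.\<close>
  have v: "g (v I) = g (v {1..card I})" if I: "I \<subseteq> {1..n}" for I
  proof -
    have "card I \<le> n" using card_mono[OF _ I] by simp
    then obtain p where p: "p permutes {1..n}" "\<And>x. x \<in> {1..n} \<Longrightarrow> p x \<in> {1..card I} \<longleftrightarrow> x \<in> I"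
      using permutation_mapping_subset[of "{1..n}" I "{1..card I}"] I by auto
    have "v {1..card I} \<circ> p = v I"
      using p(2) permutes_in_image[OF p(1)] by (force simp: v_def fun_eq_iff)
    moreover have "v {1..card I} \<in> args n" by (auto simp: v_def args_def)
    ultimately show ?thesis using sym p(1) unfolding symmetric_args_def by metis
  qed
  have "g w = (\<Sum>k\<in>{0..n}. g (v {1..k}) * sym_form n k w)" if w: "w \<in> args n" for w
  proof -
    let ?m = "\<lambda>I. (\<Prod>i\<in>I. w i $ 1) * (\<Prod>i\<in>{1..n} - I. w i $ 2)"
    \<comment> \<open>Outside \<open>{1..n}\<close> both sides are \<open>undefined\<close>, because
      \<open>w\<close> belongs to \<open>args n\<close>.\<close>
    have "(\<lambda>i. if i \<in> I then axis 1 1 else if i \<in> {1..n} then axis 2 1 else w i) = v I"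
      if "I \<subseteq> {1..n}" for I
      using w that by (auto simp: fun_eq_iff v_def args_def PiE_def extensional_def)
    then have "g w = (\<Sum>I\<in>Pow {1..n}. ?m I * g (v I))"
      by (subst multilinear_expansion[OF g w subset_refl]) (intro sum.cong, auto)
    also have "\<dots> = (\<Sum>k\<in>{0..n}. \<Sum>I | I \<in> Pow {1..n} \<and> card I = k. ?m I * g (v I))"
      by (rule sum.group[symmetric]) (auto dest: card_mono[OF finite_atLeastAtMost])
    also have "\<dots> = (\<Sum>k\<in>{0..n}. g (v {1..k}) * sym_form n k w)"
    proof (unfold sym_form_def sum_distrib_left, intro sum.cong refl)
      fix k I assume "I \<in> {I. I \<subseteq> {1..n} \<and> card I = k}"
      then show "?m I * g (v I) = g (v {1..k}) * ?m I"
        using v[of I] by simp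
    qed simp
    finally show ?thesis .
  qed
  then show ?thesis by (intro exI[of _ "\<lambda>k. g (v {1..k})"] ballI)
qed

section \<open>Existence and uniqueness of the form\<close>

lemma h_diagonal_in_args: "h_diagonal n \<gamma>\<^sub>1 \<gamma>\<^sub>2 h t \<in> args n"
  by (simp add: h_diagonal_def args_def)

theorem theorem3p5:
  fixes n :: nat and h :: real and \<gamma>\<^sub>1 \<gamma>\<^sub>2 G :: "real \<Rightarrow> real"
  assumes "n \<ge> 1"
    and "continuous_on UNIV \<gamma>\<^sub>1" and "continuous_on UNIV \<gamma>\<^sub>2"
    and "\<gamma>\<^sub>1 \<noteq> \<gamma>\<^sub>2" and "fun_space.independent {\<gamma>\<^sub>1, \<gamma>\<^sub>2}"
    and "translation_invariant \<gamma>\<^sub>1 \<gamma>\<^sub>2"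
    and "independent_family (G_fun n \<gamma>\<^sub>1 \<gamma>\<^sub>2 h) {0..n}"
    and "G \<in> pi_space n \<gamma>\<^sub>1 \<gamma>\<^sub>2"
  shows "\<exists>!g. g \<in> args n \<rightarrow>\<^sub>E UNIV \<and> symmetric_args n g \<and> multilinear n g \<and>
           (\<forall>t. g (h_diagonal n \<gamma>\<^sub>1 \<gamma>\<^sub>2 h t) = G t)"
proof (rule ex_ex1I)
  let ?T = "(\<lambda>k x. \<gamma>\<^sub>1 x ^ (n - k) * \<gamma>\<^sub>2 x ^ k) ` {0..n}"
  \<comment> \<open>The monomials number at most \<open>n + 1\<close>, which is exactly the size of
    the independent family.\<close>
  have "fun_space.span ?T \<subseteq> fun_space.span (G_fun n \<gamma>\<^sub>1 \<gamma>\<^sub>2 h ` {0..n})"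
    using G_fun_in_pi_space[OF assms(6)] card_image_le[of "{0..n}"]
    by (intro independent_family_spans[OF assms(7)]) (auto simp: pi_space_def)
  then obtain c where c: "\<And>t. G t = (\<Sum>k\<in>{0..n}. c k * G_fun n \<gamma>\<^sub>1 \<gamma>\<^sub>2 h k t)"
    using span_independent_family[OF assms(7)] assms(8) unfolding pi_space_def by blast
  \<comment> \<open>The coefficients of \<open>G\<close> in the \<open>G_fun\<close> family serve
    for the forms \<open>sym_form n k\<close>; restriction to \<open>args n\<close> makes
    \<open>g\<close> extensional.\<close>
  define g where "g = (\<lambda>w\<in>args n. \<Sum>k\<in>{0..n}. c k * sym_form n k w)"
  have "symmetric_args n g"
    unfolding symmetric_args_def
  proof (intro allI impI)
    fix p w assume p: "p permutes {1..n}" and w: "w \<in> args n"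
    have "w \<circ> p \<in> args n"
      using w permutes_not_in[OF p] by (auto simp: args_def PiE_iff extensional_def)
    then show "g (w \<circ> p) = g w" using w by (simp add: g_def sym_form_permutes[OF p])
  qed
  moreover have "multilinear n g"
    unfolding multilinear_def
  proof (intro ballI)
    fix w i assume "w \<in> args n" and i: "i \<in> {1..n}"
    \<comment> \<open>Updating slot \<open>i\<close> stays inside \<open>args n\<close>, so the
      restriction in \<open>g\<close> does not affect linearity.\<close>
    then have "w(i := z) \<in> args n" for z by (auto simp: args_def PiE_iff extensional_def)
    moreover have "linear (\<lambda>z. \<Sum>k\<in>{0..n}. c k * sym_form n k (w(i := z)))"
      using linear_compose_scale_right[OF sym_form_linear[OF i]] by (intro linear_compose_sum) simp
    ultimately show "linear (\<lambda>z. g (w(i := z)))" by (simp add: g_def)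
  qed
  moreover have "g (h_diagonal n \<gamma>\<^sub>1 \<gamma>\<^sub>2 h t) = G t" for t
    by (simp add: g_def h_diagonal_in_args sym_form_h_diagonal c)
  moreover have "g \<in> args n \<rightarrow>\<^sub>E UNIV" by (simp add: g_def)
  ultimately show "\<exists>g. g \<in> args n \<rightarrow>\<^sub>E UNIV \<and> symmetric_args n g \<and> multilinear n g \<and>
           (\<forall>t. g (h_diagonal n \<gamma>\<^sub>1 \<gamma>\<^sub>2 h t) = G t)"
    by blast
next
  fix g g'
  assume g: "g \<in> args n \<rightarrow>\<^sub>E UNIV \<and> symmetric_args n g \<and> multilinear n g \<and>
           (\<forall>t. g (h_diagonal n \<gamma>\<^sub>1 \<gamma>\<^sub>2 h t) = G t)"
    and g': "g' \<in> args n \<rightarrow>\<^sub>E UNIV \<and> symmetric_args n g' \<and> multilinear n g' \<and>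
           (\<forall>t. g' (h_diagonal n \<gamma>\<^sub>1 \<gamma>\<^sub>2 h t) = G t)"
  obtain c where c: "\<And>w. w \<in> args n \<Longrightarrow> g w = (\<Sum>k\<in>{0..n}. c k * sym_form n k w)"
    using symmetric_multilinear_eq_sum_sym_form g by metis
  obtain c' where c': "\<And>w. w \<in> args n \<Longrightarrow> g' w = (\<Sum>k\<in>{0..n}. c' k * sym_form n k w)"
    using symmetric_multilinear_eq_sum_sym_form g' by metis
  \<comment> \<open>On the diagonal both expansions become combinations of the \<open>G_fun\<close>
    family with the same value \<open>G t\<close>; independence then forces equal
    coefficients.\<close>
  have "(\<Sum>k\<in>{0..n}. (c k - c' k) * G_fun n \<gamma>\<^sub>1 \<gamma>\<^sub>2 h k t) = 0" for t
  proof -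
    have "g (h_diagonal n \<gamma>\<^sub>1 \<gamma>\<^sub>2 h t) = g' (h_diagonal n \<gamma>\<^sub>1 \<gamma>\<^sub>2 h t)" using g g' by simp
    then show ?thesis
      by (simp add: c c' h_diagonal_in_args sym_form_h_diagonal left_diff_distrib sum_subtractf)
  qed
  then have "c k - c' k = 0" if "k \<in> {0..n}" for k
    using independent_familyD[OF assms(7) finite_atLeastAtMost _ that, of "\<lambda>k. c k - c' k"] by blast
  then have "g w = g' w" if "w \<in> args n" for w
    using that by (simp add: c c')
  then show "g = g'" using g g' by (meson PiE_ext)
qed

end
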